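(* For $n\in\mathbb{N}_{\ge1}$ let $\mu_n$ and $\nu_{n,n}=\mu_nP_{\frac{\pi}{2n}}$ be the probability measures on $\mathbb{R}^2$ defined in the context. Then $$\lim_{n\to\infty}\frac{\mathcal{M}_1(\mu_n,\nu_{n,n})}{\mathcal{W}_1(\mu_n,\nu_{n,n})}=+\infty.$$
   Context: $\|\cdot\|$ is the Euclidean norm. For probability measures $\mu,\nu$ on $\mathbb{R}^d$ with finite first moment, $\Pi(\mu,\nu)$ is the set of couplings, i.e. probability measures on $\mathbb{R}^d\times\mathbb{R}^d$ with first marginal $\mu$ and second marginal $\nu$, and $\mathcal{W}_1(\mu,\nu)=\inf_{\pi\in\Pi(\mu,\nu)}\int\|y-x\|\,\mathrm{d}\pi(x,y)$ is the 1-Wasserstein distance. A coupling $\pi\in\Pi(\mu,\nu)$ is a martingale coupling if it has a disintegration $(\pi_x)_{x\in\mathbb{R}^d}$ with respect to $\mu$ such that $\int_{\mathbb{R}^d} y\,\mathrm{d}\pi_x(y)=x$ for $\mu$-a.e. $x$. $\Pi_M(\mu,\nu)$ denotes the set of all martingale couplings between $\mu$ and $\nu$. For $\mu$ smaller than $\nu$ in convex order, $\mathcal{M}_1(\mu,\nu):=\inf_{\pi\in\Pi_M(\mu,\nu)}\int\|x-y\|\,\mathrm{d}\pi(x,y)$. For $\theta\in[0,\frac{\pi}{2}]$, $P_\theta$ is the probability kernel on $\mathbb{R}^2$ given by $$P_\theta\big((x_1,x_2),\cdot\big)=\tfrac12\left(\delta_{(x_1,x_2)+(\cos\theta,\sin\theta)}+\delta_{(x_1,x_2)-(\cos\theta,\sin\theta)}\right).$$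 For a probability measure $\mu$ on $\mathbb{R}^2$, $\mu P_\theta$ denotes the measure $\int P_\theta(x,\cdot)\,\mathrm{d}\mu(x)$ on $\mathbb{R}^2$. For $m,n\in\mathbb{N}_{\ge1}$: $\mu_m:=\sum_{i=1}^m\frac1m\delta_{(i,0)}$ and $\nu_{m,n}:=\mu_mP_{\frac{\pi}{2n}}$, probability measures on $\mathbb{R}^2$. One has $\mu_m\le_c\nu_{m,n}$ in convex order. *)

theory Defs
  imports "HOL-Probability.Probability"
begin

definition couplings :: "'a::euclidean_space measure \<Rightarrow> 'a measure \<Rightarrow> ('a \<times> 'a) measure set" where
  "couplings \<mu> \<nu> =
    {\<pi>. prob_space \<pi> \<and> sets \<pi> = sets (borel \<Otimes>\<^sub>M borel)
       \<and> distr \<pi> borel fst = \<mu> \<and> distr \<pi> borel snd = \<nu>}"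

text \<open>
  A disintegration of \<open>\<pi>\<close> with respect to its first marginal \<open>\<mu>\<close> is a measurable probability kernel
  \<open>\<kappa>\<close> with \<open>\<pi>(dx, dy) = \<kappa> x (dy) \<mu>(dx)\<close>; measurable rectangles determine \<open>\<pi>\<close>.
\<close>

definition disintegration ::
  "'a::euclidean_space measure \<Rightarrow> ('a \<times> 'a) measure \<Rightarrow> ('a \<Rightarrow> 'a measure) \<Rightarrow> bool" where
  "disintegration \<mu> \<pi> \<kappa> \<longleftrightarrow>
    \<kappa> \<in> borel \<rightarrow>\<^sub>M prob_algebra borel \<and>
    (\<forall>A\<in>sets borel. \<forall>B\<in>sets borel.
       emeasure \<pi> (A \<times> B) = (\<integral>\<^sup>+x\<in>A. emeasure (\<kappa> x) B \<partial>\<mu>))"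

text \<open>
  Integrability of the identity is required explicitly, because the Bochner integral of a
  non-integrable function is \<open>0\<close> by convention.
\<close>

definition martingale_couplings ::
  "'a::euclidean_space measure \<Rightarrow> 'a measure \<Rightarrow> ('a \<times> 'a) measure set" where
  "martingale_couplings \<mu> \<nu> =
    {\<pi> \<in> couplings \<mu> \<nu>. \<exists>\<kappa>. disintegration \<mu> \<pi> \<kappa> \<and>
       (AE x in \<mu>. integrable (\<kappa> x) (\<lambda>y. y) \<and> (\<integral>y. y \<partial>\<kappa> x) = x)}"

text \<open>
  Both infima are taken in the extended nonnegative reals and then read as real numbers. They are
  finite whenever \<open>\<mu>\<close> and \<open>\<nu>\<close> have finite first moments and, for the second one, \<open>\<mu>\<close> is smaller than
  \<open>\<nu>\<close> in convex order; outside of that domain \<open>enn2real\<close> maps \<open>\<infinity>\<close> to \<open>0\<close>.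
\<close>

definition wasserstein1 :: "'a::euclidean_space measure \<Rightarrow> 'a measure \<Rightarrow> real" where
  "wasserstein1 \<mu> \<nu> =
    enn2real (INF \<pi>\<in>couplings \<mu> \<nu>. \<integral>\<^sup>+(x, y). ennreal (norm (y - x)) \<partial>\<pi>)"

definition martingale_wasserstein1 :: "'a::euclidean_space measure \<Rightarrow> 'a measure \<Rightarrow> real" where
  "martingale_wasserstein1 \<mu> \<nu> =
    enn2real (INF \<pi>\<in>martingale_couplings \<mu> \<nu>. \<integral>\<^sup>+(x, y). ennreal (norm (x - y)) \<partial>\<pi>)"

definition P_kernel :: "real \<Rightarrow> real ^ 2 \<Rightarrow> (real ^ 2) measure" where
  "P_kernel \<theta> x = measure_of UNIV (sets borel)
    (\<lambda>A. 1 / 2 * (emeasure (return borel (x + vector [cos \<theta>, sin \<theta>])) A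
                + emeasure (return borel (x - vector [cos \<theta>, sin \<theta>])) A))"

definition \<mu>_points :: "nat \<Rightarrow> (real ^ 2) measure" where
  "\<mu>_points m = measure_of UNIV (sets borel)
    (\<lambda>A. \<Sum>i=1..m. ennreal (1 / real m) * emeasure (return borel (vector [real i, 0])) A)"

definition \<nu>_points :: "nat \<Rightarrow> nat \<Rightarrow> (real ^ 2) measure" where
  "\<nu>_points m n = \<mu>_points m \<bind> P_kernel (pi / (2 * real n))"

text \<open>
  The set functions above are measures, so \<open>measure_of\<close> does not collapse to the null measure, and
  \<open>P_kernel \<theta>\<close> is a measurable kernel, so the monadic bind is the usual action on measures.
\<close>

lemma emeasure_measure_of_borel_sum:
  fixes N :: "'i \<Rightarrow> 'a::topological_space measure"
  assumes "\<And>i. sets (N i) = sets borel" "A \<in> sets borel"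
  shows "emeasure (measure_of UNIV (sets borel) (\<lambda>A. \<Sum>i\<in>I. c i * emeasure (N i) A)) A
       = (\<Sum>i\<in>I. c i * emeasure (N i) A)"
proof (rule emeasure_measure_of_sigma)
  show "sigma_algebra UNIV (sets (borel :: 'a measure))"
    using sets.sigma_algebra_axioms[of "borel :: 'a measure"] by simp
  show "positive (sets borel) (\<lambda>A. \<Sum>i\<in>I. c i * emeasure (N i) A)"
    by (simp add: positive_def)
  show "countably_additive (sets borel) (\<lambda>A. \<Sum>i\<in>I. c i * emeasure (N i) A)"
  proof (rule countably_additiveI)
    fix B :: "nat \<Rightarrow> 'a set"
    assume B: "range B \<subseteq> sets borel" "disjoint_family B"
    have "(\<Sum>j. \<Sum>i\<in>I. c i * emeasure (N i) (B j)) = (\<Sum>i\<in>I. \<Sum>j. c i * emeasure (N i) (B j))"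
      by (rule suminf_sum) simp
    also have "\<dots> = (\<Sum>i\<in>I. c i * emeasure (N i) (\<Union>j. B j))"
      using B assms(1) by (simp add: suminf_emeasure)
    finally show "(\<Sum>j. \<Sum>i\<in>I. c i * emeasure (N i) (B j))
                = (\<Sum>i\<in>I. c i * emeasure (N i) (\<Union>j. B j))" .
  qed
qed (fact assms(2))

lemma sets_P_kernel [simp]: "sets (P_kernel \<theta> x) = sets borel"
  using sets.sigma_sets_eq[of "borel :: (real ^ 2) measure"] by (simp add: P_kernel_def)

lemma sets_\<mu>_points [simp]: "sets (\<mu>_points m) = sets borel"
  using sets.sigma_sets_eq[of "borel :: (real ^ 2) measure"] by (simp add: \<mu>_points_def)

lemma emeasure_P_kernel:
  assumes "A \<in> sets borel"
  shows "emeasure (P_kernel \<theta> x) A =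
    1 / 2 * (indicator A (x + vector [cos \<theta>, sin \<theta>]) + indicator A (x - vector [cos \<theta>, sin \<theta>]))"
proof -
  define N :: "bool \<Rightarrow> (real ^ 2) measure" where
    "N b = return borel (if b then x + vector [cos \<theta>, sin \<theta>] else x - vector [cos \<theta>, sin \<theta>])" for b
  have "P_kernel \<theta> x = measure_of UNIV (sets borel) (\<lambda>A. \<Sum>b\<in>UNIV. 1 / 2 * emeasure (N b) A)"
    by (simp add: P_kernel_def N_def UNIV_bool distrib_left add.commute)
  then have "emeasure (P_kernel \<theta> x) A = (\<Sum>b\<in>UNIV. 1 / 2 * emeasure (N b) A)"
    using emeasure_measure_of_borel_sum[of N A "\<lambda>_. 1 / 2" UNIV] assms
    by (simp only:) (simp add: N_def)
  also have "\<dots> = 1 / 2 * emeasure (N False) A + 1 / 2 * emeasure (N True) A"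
    by (simp only: UNIV_bool) simp
  finally show ?thesis
    using assms by (simp add: N_def distrib_left add.commute)
qed

lemma emeasure_\<mu>_points:
  assumes "A \<in> sets borel"
  shows "emeasure (\<mu>_points m) A =
    (\<Sum>i=1..m. ennreal (1 / real m) * indicator A (vector [real i, 0]))"
  unfolding \<mu>_points_def
  by (subst emeasure_measure_of_borel_sum) (simp_all add: assms)

lemma prob_space_P_kernel: "prob_space (P_kernel \<theta> x)"
proof
  have "(1 :: ennreal) / 2 * 2 = 1"
    by (simp add: ennreal_divide_times)
  then show "emeasure (P_kernel \<theta> x) (space (P_kernel \<theta> x)) = 1"
    using sets_eq_imp_space_eq[OF sets_P_kernel, of \<theta> x] by (simp add: emeasure_P_kernel)
qed

lemma prob_space_\<mu>_points:
  assumes "m \<ge> 1"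
  shows "prob_space (\<mu>_points m)"
proof
  have "(\<Sum>i=1..m. ennreal (1 / real m)) = ennreal (\<Sum>i=1..m. 1 / real m)"
    by (rule sum_ennreal) simp
  also have "\<dots> = 1"
    using assms by simp
  finally show "emeasure (\<mu>_points m) (space (\<mu>_points m)) = 1"
    using sets_eq_imp_space_eq[OF sets_\<mu>_points, of m] emeasure_\<mu>_points[of UNIV m] by simp
qed

lemma measurable_P_kernel: "P_kernel \<theta> \<in> borel \<rightarrow>\<^sub>M prob_algebra borel"
proof (rule measurable_prob_algebraI)
  show "P_kernel \<theta> \<in> borel \<rightarrow>\<^sub>M subprob_algebra borel"
  proof (rule measurable_subprob_algebra)
    fix A :: "(real ^ 2) set" assume [measurable]: "A \<in> sets borel"
    show "(\<lambda>x. emeasure (P_kernel \<theta> x) A) \<in> borel_measurable borel"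
      by (simp add: emeasure_P_kernel)
  qed (simp_all add: prob_space_P_kernel prob_space_imp_subprob_space)
qed (rule prob_space_P_kernel)

lemma emeasure_\<nu>_points:
  assumes "A \<in> sets borel"
  shows "emeasure (\<nu>_points m n) A = (\<integral>\<^sup>+x. emeasure (P_kernel (pi / (2 * real n)) x) A \<partial>\<mu>_points m)"
  unfolding \<nu>_points_def
  using sets_eq_imp_space_eq[OF sets_\<mu>_points, of m] assms
  by (intro emeasure_bind[where N = borel])
    (auto simp: measurable_cong_sets[OF sets_\<mu>_points refl] measurable_P_kernel[THEN measurable_prob_algebraD])

end

theory Submission
  imports Defs
begin

text \<open>
  Put \<open>\<theta> = \<pi> / (2n)\<close> and \<open>v = (cos \<theta>, sin \<theta>)\<close>. The kernel splits each atom \<open>(i, 0)\<close> into \<open>(i, 0) + v\<close> and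
  \<open>(i, 0) - v\<close>, at distance 1. For large \<open>n\<close>, \<open>v\<close> is almost the unit vector \<open>(1, 0)\<close>, so the split atoms nearly
  coincide with the neighbouring original atoms, and the two costs react to this very differently.

  \<^item> An arbitrary coupling may feed \<open>(j, 0) + v\<close> from \<open>(j + 1, 0)\<close> and \<open>(j, 0) - v\<close> from \<open>(j - 1, 0)\<close>,
    over a distance of at most \<open>\<theta>\<close>. Only the two outermost targets have no such neighbour. They take
    the mass left over at the two ends of the row, over distance 1, and carry mass \<open>1/n\<close> together.
    So \<open>W\<^sub>1 \<le> \<theta> + 1/n = (\<pi>/2 + 1)/n\<close> (\<open>wasserstein1_upper\<close>).

  \<^item> A martingale coupling cannot do this. Let \<open>(X, Y)\<close> have such a coupling as its law. All \<open>X\<close> lie on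
    the first axis, so the conditional mean of \<open>Y\<^sub>2\<close> given \<open>X\<close> vanishes and \<open>E[X\<^sub>1 Y\<^sub>2] = 0\<close>
    (\<open>martingale_coupling_orthogonal\<close>). The expectation \<open>E[Y\<^sub>1 Y\<^sub>2] = cos \<theta> sin \<theta>\<close> depends on the second
    marginal only, and \<open>\<bar>Y\<^sub>2\<bar> = sin \<theta>\<close>. Hence
    \<open>sin \<theta> E\<parallel>X - Y\<parallel> \<ge> E[(Y\<^sub>1 - X\<^sub>1) Y\<^sub>2] = cos \<theta> sin \<theta>\<close>, that is, \<open>M\<^sub>1 \<ge> cos \<theta>\<close>
    (\<open>martingale_wasserstein1_lower\<close>).

  The ratio is therefore at least \<open>n cos \<theta> / (\<pi>/2 + 1)\<close>, which tends to infinity. Since costs are read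
  off with \<open>enn2real\<close> and division by zero yields zero, this also needs \<open>W\<^sub>1 > 0\<close>
  (\<open>wasserstein1_lower\<close>) and \<open>M\<^sub>1 < \<infinity>\<close> (\<open>martingale_wasserstein1_upper\<close>).
\<close>

section \<open>Empirical measures\<close>

text \<open>
  All measures and couplings built below are uniform distributions over a finite index set, pushed
  forward. Atoms may coincide, so equal weights suffice, and a coupling is just a pair of point
  families over one index set.
\<close>

definition empirical :: "'i set \<Rightarrow> ('i \<Rightarrow> 'a::topological_space) \<Rightarrow> 'a measure" where
  "empirical I f = distr (measure_pmf (pmf_of_set I)) borel f"

lemma sets_empirical [simp]: "sets (empirical I f) = sets borel"
  by (simp add: empirical_def)

lemma space_empirical [simp]: "space (empirical I f) = UNIV"
  by (simp add: empirical_def)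

lemma prob_space_empirical: "prob_space (empirical I f)"
  unfolding empirical_def by (rule measure_pmf.prob_space_distr) simp

lemma nn_integral_empirical:
  assumes "finite I" "I \<noteq> {}" "g \<in> borel_measurable borel"
  shows "(\<integral>\<^sup>+x. g x \<partial>empirical I f) = (\<Sum>i\<in>I. g (f i)) / of_nat (card I)"
  using assms by (simp add: empirical_def nn_integral_distr nn_integral_pmf_of_set)

lemma emeasure_empirical:
  assumes "finite I" "I \<noteq> {}" "A \<in> sets borel"
  shows "emeasure (empirical I f) A = (\<Sum>i\<in>I. indicator A (f i)) / of_nat (card I)"
  using nn_integral_empirical[of I "indicator A" f] assms by simp

lemma AE_empirical:
  assumes "finite I" "I \<noteq> {}" "{x. P x} \<in> sets borel" "\<And>i. i \<in> I \<Longrightarrow> P (f i)"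
  shows "AE x in empirical I f. P x"
  unfolding empirical_def using assms
  by (subst AE_distr_iff) (simp_all add: AE_measure_pmf_iff)

lemma empirical_in_couplings:
  fixes f g :: "'i \<Rightarrow> 'a::euclidean_space"
  shows "empirical I (\<lambda>i. (f i, g i)) \<in> couplings (empirical I f) (empirical I g)"
proof -
  have [measurable]: "fst \<in> borel_measurable (borel :: ('a \<times> 'a) measure)"
    "snd \<in> borel_measurable (borel :: ('a \<times> 'a) measure)"
    by (auto simp: borel_prod[symmetric])
  show ?thesis
    unfolding couplings_def
    by (simp only: mem_Collect_eq prob_space_empirical sets_empirical borel_prod)
      (simp add: empirical_def distr_distr comp_def)
qed

lemma ennreal_sum_halves:
  fixes h :: "'i \<Rightarrow> ennreal"
  shows "(\<Sum>i\<in>I. h i / 2) / of_nat m = (\<Sum>i\<in>I. h i) / (2 * of_nat m)"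
proof -
  have "inverse (2 * of_nat m :: ennreal) = inverse 2 * inverse (of_nat m)"
    using ennreal_inverse_mult[of 2 "of_nat m"] by (simp add: of_nat_less_top)
  then show ?thesis
    by (simp add: divide_ennreal_def mult.assoc flip: sum_distrib_right)
qed

lemma ennreal_mean:
  assumes "finite I" "\<And>i. i \<in> I \<Longrightarrow> 0 \<le> h i" "0 < k"
  shows "(\<Sum>i\<in>I. ennreal (h i)) / of_nat k = ennreal ((\<Sum>i\<in>I. h i) / real k)"
  using assms
  by (simp add: sum_ennreal ennreal_of_nat_eq_real_of_nat divide_ennreal sum_nonneg)

section \<open>Integration against a disintegrated measure\<close>

text \<open>
  Rectangles are stable under intersection and generate the product sets, so \<open>\<pi>\<close> is the
  composition of \<open>\<mu>\<close> with the kernel that sends \<open>x\<close> to the image of \<open>\<kappa> x\<close> under \<open>Pair x\<close>. The formula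
  is then integration against a composition.
\<close>

lemma nn_integral_disintegration:
  fixes \<mu> :: "'a::euclidean_space measure"
  assumes dis: "disintegration \<mu> \<pi> \<kappa>"
    and sets: "sets \<mu> = sets borel" "sets \<pi> = sets (borel \<Otimes>\<^sub>M borel)"
    and fin: "finite_measure \<pi>"
    and f [measurable]: "f \<in> borel_measurable (borel \<Otimes>\<^sub>M (borel :: 'a measure))"
  shows "(\<integral>\<^sup>+z. f z \<partial>\<pi>) = (\<integral>\<^sup>+x. \<integral>\<^sup>+y. f (x, y) \<partial>\<kappa> x \<partial>\<mu>)"
proof -
  note [measurable_cong] = sets(1)
  have \<kappa>: "\<kappa> \<in> borel \<rightarrow>\<^sub>M subprob_algebra borel"
    and rect: "\<And>A B. A \<in> sets borel \<Longrightarrow> B \<in> sets borel \<Longrightarrow>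
      emeasure \<pi> (A \<times> B) = (\<integral>\<^sup>+x\<in>A. emeasure (\<kappa> x) B \<partial>\<mu>)"
    using dis by (auto simp: disintegration_def intro: measurable_prob_algebraD)
  have sets_\<kappa>: "sets (\<kappa> x) = sets borel" for x
    using subprob_measurableD(2)[OF \<kappa>, of x] by simp
  note [measurable_cong] = sets_\<kappa>
  define K where "K x = distr (\<kappa> x) (borel \<Otimes>\<^sub>M borel) (Pair x)" for x :: 'a
  have K: "K \<in> borel \<rightarrow>\<^sub>M subprob_algebra (borel \<Otimes>\<^sub>M borel)"
    unfolding K_def by (rule measurable_distr2[OF _ \<kappa>]) simp
  then have K\<mu>: "K \<in> \<mu> \<rightarrow>\<^sub>M subprob_algebra (borel \<Otimes>\<^sub>M borel)"
    by (simp cong: measurable_cong_sets add: sets)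
  have ne: "space \<mu> \<noteq> {}"
    using sets_eq_imp_space_eq[OF sets(1)] by simp
  have "\<pi> = \<mu> \<bind> K"
  proof (rule measure_eqI_generator_eq[where A = "\<lambda>_. UNIV" and \<Omega> = UNIV
        and E = "{A \<times> B | A B. A \<in> sets (borel :: 'a measure) \<and> B \<in> sets (borel :: 'a measure)}"])
    show "Int_stable {A \<times> B | A B. A \<in> sets (borel :: 'a measure) \<and> B \<in> sets (borel :: 'a measure)}"
      using Int_stable_pair_measure_generator[of borel borel] by simp
    have "sets (borel \<Otimes>\<^sub>M borel :: ('a \<times> 'a) measure)
        = sigma_sets UNIV {A \<times> B | A B. A \<in> sets (borel :: 'a measure) \<and> B \<in> sets borel}"
      by (simp add: sets_pair_measure)
    then show "sets \<pi> = sigma_sets UNIV {A \<times> B | A B. A \<in> sets (borel :: 'a measure) \<and> B \<in> sets borel}"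
      "sets (\<mu> \<bind> K) = sigma_sets UNIV {A \<times> B | A B. A \<in> sets (borel :: 'a measure) \<and> B \<in> sets borel}"
      by (simp_all add: sets sets_bind[OF subprob_measurableD(2)[OF K\<mu>] ne])
    show "range (\<lambda>_. UNIV) \<subseteq> {A \<times> B | A B. A \<in> sets (borel :: 'a measure) \<and> B \<in> sets (borel :: 'a measure)}"
      by (auto intro!: exI[of _ UNIV])
    show "emeasure \<pi> UNIV \<noteq> \<infinity>"
      by (simp add: finite_measure.emeasure_finite[OF fin])
    fix X assume "X \<in> {A \<times> B | A B. A \<in> sets (borel :: 'a measure) \<and> B \<in> sets (borel :: 'a measure)}"
    then obtain A B where X: "X = A \<times> B" and [measurable]: "A \<in> sets borel" "B \<in> sets borel"
      by blast
    have "emeasure (\<mu> \<bind> K) X = (\<integral>\<^sup>+x. emeasure (K x) X \<partial>\<mu>)"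
      by (rule emeasure_bind[OF ne K\<mu>]) (simp add: X)
    also have "\<dots> = (\<integral>\<^sup>+x\<in>A. emeasure (\<kappa> x) B \<partial>\<mu>)"
    proof (rule nn_integral_cong)
      fix x
      have "Pair x -` (A \<times> B) = (if x \<in> A then B else {})" by auto
      then show "emeasure (K x) X = emeasure (\<kappa> x) B * indicator A x"
        using sets_eq_imp_space_eq[OF sets_\<kappa>, of x]
        by (simp add: K_def X emeasure_distr split: split_indicator)
    qed
    finally show "emeasure \<pi> X = emeasure (\<mu> \<bind> K) X"
      by (simp add: X rect)
  qed simp_all
  then have "(\<integral>\<^sup>+z. f z \<partial>\<pi>) = (\<integral>\<^sup>+x. \<integral>\<^sup>+z. f z \<partial>K x \<partial>\<mu>)"
    by (simp add: nn_integral_bind[OF f K\<mu>])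
  also have "\<dots> = (\<integral>\<^sup>+x. \<integral>\<^sup>+y. f (x, y) \<partial>\<kappa> x \<partial>\<mu>)"
    unfolding K_def by (simp add: nn_integral_distr)
  finally show ?thesis .
qed

section \<open>Couplings\<close>

lemma coupling_marginals:
  assumes "\<pi> \<in> couplings \<mu> \<nu>"
  shows "sets \<pi> = sets (borel \<Otimes>\<^sub>M borel)" "prob_space \<pi>"
    and "f \<in> borel_measurable borel \<Longrightarrow> (\<integral>\<^sup>+z. f (fst z) \<partial>\<pi>) = (\<integral>\<^sup>+x. f x \<partial>\<mu>)"
    and "f \<in> borel_measurable borel \<Longrightarrow> (\<integral>\<^sup>+z. f (snd z) \<partial>\<pi>) = (\<integral>\<^sup>+y. f y \<partial>\<nu>)"
    and "AE x in \<mu>. P x \<Longrightarrow> AE z in \<pi>. P (fst z)"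
    and "AE y in \<nu>. Q y \<Longrightarrow> AE z in \<pi>. Q (snd z)"
proof -
  show sets: "sets \<pi> = sets (borel \<Otimes>\<^sub>M borel)" "prob_space \<pi>"
    using assms by (auto simp: couplings_def)
  note [measurable_cong] = sets(1)
  have \<mu>: "\<mu> = distr \<pi> borel fst" and \<nu>: "\<nu> = distr \<pi> borel snd"
    using assms by (auto simp: couplings_def)
  show "(\<integral>\<^sup>+z. f (fst z) \<partial>\<pi>) = (\<integral>\<^sup>+x. f x \<partial>\<mu>)" if "f \<in> borel_measurable borel"
    unfolding \<mu> using that by (simp add: nn_integral_distr)
  show "(\<integral>\<^sup>+z. f (snd z) \<partial>\<pi>) = (\<integral>\<^sup>+y. f y \<partial>\<nu>)" if "f \<in> borel_measurable borel"
    unfolding \<nu> using that by (simp add: nn_integral_distr)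
  show "AE z in \<pi>. P (fst z)" if "AE x in \<mu>. P x"
    using that unfolding \<mu> by (rule AE_distrD[rotated]) simp
  show "AE z in \<pi>. Q (snd z)" if "AE y in \<nu>. Q y"
    using that unfolding \<nu> by (rule AE_distrD[rotated]) simp
qed

lemma measurable_distance:
  "(\<lambda>(x, y). ennreal (norm (x - y :: 'a::euclidean_space))) \<in> borel_measurable borel"
  "(\<lambda>(x, y). ennreal (norm (y - x :: 'a::euclidean_space))) \<in> borel_measurable borel"
  unfolding borel_prod[symmetric] by measurable

text \<open>
  This is \<open>E[f(X) Y\<^sub>k] = 0\<close>, written as equality of the contributions of the positive and the negative
  part of \<open>Y\<^sub>k\<close>, which keeps it meaningful without integrability of \<open>f\<close>. It holds because the
  martingale property makes both parts have the same conditional mean given \<open>X\<close>, as soon as \<open>X\<^sub>k = 0\<close>.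
\<close>

lemma martingale_coupling_orthogonal:
  fixes \<mu> \<nu> :: "(real ^ 'd) measure"
  assumes \<pi>: "\<pi> \<in> martingale_couplings \<mu> \<nu>"
    and \<mu>: "sets \<mu> = sets borel" "AE x in \<mu>. x $ k = 0"
    and f: "f \<in> borel_measurable borel"
  shows "(\<integral>\<^sup>+z. f (fst z) * ennreal (snd z $ k) \<partial>\<pi>) = (\<integral>\<^sup>+z. f (fst z) * ennreal (- snd z $ k) \<partial>\<pi>)"
proof -
  obtain \<kappa> where coupling: "\<pi> \<in> couplings \<mu> \<nu>" and dis: "disintegration \<mu> \<pi> \<kappa>"
    and mart: "AE x in \<mu>. integrable (\<kappa> x) (\<lambda>y. y) \<and> (\<integral>y. y \<partial>\<kappa> x) = x"
    using \<pi> by (auto simp: martingale_couplings_def)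
  have \<kappa>: "\<kappa> \<in> borel \<rightarrow>\<^sub>M prob_algebra borel"
    using dis by (simp add: disintegration_def)
  have sets_\<kappa>: "sets (\<kappa> x) = sets borel" for x
    using subprob_measurableD(2)[OF measurable_prob_algebraD[OF \<kappa>], of x] by simp
  note [measurable_cong] = sets_\<kappa>
  note [measurable] = f
  have [measurable]: "(\<lambda>y :: real ^ 'd. y $ k) \<in> borel_measurable borel"
    by (intro borel_measurable_continuous_onI continuous_intros)
  have disint: "(\<integral>\<^sup>+z. g z \<partial>\<pi>) = (\<integral>\<^sup>+x. \<integral>\<^sup>+y. g (x, y) \<partial>\<kappa> x \<partial>\<mu>)"
    if "g \<in> borel_measurable (borel \<Otimes>\<^sub>M borel)" for g
    using nn_integral_disintegration[OF dis \<mu>(1) coupling_marginals(1)[OF coupling] _ that]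
      coupling_marginals(2)[OF coupling] by (simp add: prob_space_def)
  have "(\<integral>\<^sup>+z. f (fst z) * ennreal (snd z $ k) \<partial>\<pi>)
      = (\<integral>\<^sup>+x. f x * (\<integral>\<^sup>+y. ennreal (y $ k) \<partial>\<kappa> x) \<partial>\<mu>)"
    by (subst disint) (simp_all add: nn_integral_cmult)
  also have "\<dots> = (\<integral>\<^sup>+x. f x * (\<integral>\<^sup>+y. ennreal (- y $ k) \<partial>\<kappa> x) \<partial>\<mu>)"
  proof (rule nn_integral_cong_AE, use mart \<mu>(2) in eventually_elim)
    case (elim x)
    then have int: "integrable (\<kappa> x) (\<lambda>y. y $ k)" and "(\<integral>y. y $ k \<partial>\<kappa> x) = 0"
      using integrable_bounded_linear[OF bounded_linear_vec_nth[of k], of "\<kappa> x" "\<lambda>y. y"]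
        integral_bounded_linear[OF bounded_linear_vec_nth[of k], of "\<kappa> x" "\<lambda>y. y"] by auto
    then have eq: "enn2real (\<integral>\<^sup>+y. ennreal (y $ k) \<partial>\<kappa> x) = enn2real (\<integral>\<^sup>+y. ennreal (- y $ k) \<partial>\<kappa> x)"
      by (simp add: real_lebesgue_integral_def)
    have "(\<integral>\<^sup>+y. ennreal (y $ k) \<partial>\<kappa> x) < \<top>" "(\<integral>\<^sup>+y. ennreal (- y $ k) \<partial>\<kappa> x) < \<top>"
      using int by (auto simp: real_integrable_def top.not_eq_extremum)
    then show ?case
      using eq by (metis ennreal_enn2real)
  qed
  also have "\<dots> = (\<integral>\<^sup>+z. f (fst z) * ennreal (- snd z $ k) \<partial>\<pi>)"
    by (subst disint) (simp_all add: nn_integral_cmult)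
  finally show ?thesis .
qed

section \<open>The measures of the example\<close>

lemma sum_signed_points:
  fixes g :: "nat \<times> bool \<Rightarrow> 'b::comm_monoid_add"
  shows "(\<Sum>p\<in>{1..m} \<times> UNIV. g p) = (\<Sum>j=1..m. g (j, True) + g (j, False))"
  using sum.cartesian_product[of "\<lambda>j b. g (j, b)" "UNIV :: bool set" "{1..m}"]
  by (simp add: case_prod_beta UNIV_bool add.commute)

text \<open>
  Couplings are indexed by the \<open>2m\<close> atoms of the second marginal. A family of sources for these
  atoms has the right first marginal when it visits each of the \<open>m\<close> points exactly twice.
\<close>

lemma empirical_eq_\<mu>_points:
  assumes "m \<ge> 1"
    and "\<And>g :: real ^ 2 \<Rightarrow> ennreal. (\<Sum>p\<in>{1..m} \<times> (UNIV :: bool set). g (f p)) = 2 * (\<Sum>j=1..m. g (vector [real j, 0]))"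
  shows "empirical ({1..m} \<times> (UNIV :: bool set)) f = \<mu>_points m"
proof (rule measure_eqI)
  fix A assume "A \<in> sets (empirical ({1..m} \<times> (UNIV :: bool set)) f)"
  then have A: "A \<in> sets borel" by simp
  have "emeasure (empirical ({1..m} \<times> (UNIV :: bool set)) f) A
      = 2 * (\<Sum>j=1..m. indicator A (vector [real j, 0])) / (2 * of_nat m)"
    using assms A by (subst emeasure_empirical) (simp_all add: mult.commute del: sum_distrib_left)
  also have "\<dots> = (\<Sum>j=1..m. 2 * indicator A (vector [real j, 0]) / 2) / of_nat m"
    by (simp only: ennreal_sum_halves sum_distrib_left)
  also have "\<dots> = (\<Sum>j=1..m. indicator A (vector [real j, 0])) / of_nat m"
    by (intro arg_cong2[where f = "(/)"] sum.cong refl) (simp split: split_indicator)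
  also have "(\<Sum>j=1..m. indicator A (vector [real j, 0])) / of_nat m = emeasure (\<mu>_points m) A"
  proof -
    have "ennreal (1 / real m) = 1 / of_nat m"
      using assms(1) by (simp add: divide_ennreal[symmetric] ennreal_of_nat_eq_real_of_nat del: divide_ennreal)
    then show ?thesis
      using A by (simp add: emeasure_\<mu>_points divide_ennreal_def mult.commute flip: sum_distrib_left)
  qed
  finally show "emeasure (empirical ({1..m} \<times> (UNIV :: bool set)) f) A = emeasure (\<mu>_points m) A" .
qed simp

definition centre :: "nat \<Rightarrow> real ^ 2" where
  "centre j = vector [real j, 0]"

definition step :: "real \<Rightarrow> real ^ 2" where
  "step \<theta> = vector [cos \<theta>, sin \<theta>]"

definition endpoint :: "real \<Rightarrow> nat \<times> bool \<Rightarrow> real ^ 2" where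
  "endpoint \<theta> = (\<lambda>(j, up). if up then centre j + step \<theta> else centre j - step \<theta>)"

lemma vec2_simps [simp]:
  "centre j $ 1 = real j" "centre j $ 2 = 0"
  "step \<theta> $ 1 = cos \<theta>" "step \<theta> $ 2 = sin \<theta>"
  "endpoint \<theta> (j, up) $ 1 = (if up then real j + cos \<theta> else real j - cos \<theta>)"
  "endpoint \<theta> (j, up) $ 2 = (if up then sin \<theta> else - sin \<theta>)"
  by (simp_all add: centre_def step_def endpoint_def)

lemma \<mu>_points_empirical:
  assumes "m \<ge> 1"
  shows "\<mu>_points m = empirical {1..m} centre"
proof (rule measure_eqI)
  fix A assume "A \<in> sets (\<mu>_points m)"
  then have A: "A \<in> sets borel" by simp
  have "ennreal (1 / real m) = 1 / of_nat m"
    using assms by (simp add: divide_ennreal[symmetric] ennreal_of_nat_eq_real_of_nat del: divide_ennreal)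
  then show "emeasure (\<mu>_points m) A = emeasure (empirical {1..m} centre) A"
    using assms A
    by (simp add: emeasure_\<mu>_points emeasure_empirical centre_def sum_distrib_left[symmetric]
        ennreal_times_divide mult.commute divide_ennreal_def)
qed simp

lemma P_kernel_empirical:
  "P_kernel \<theta> x = empirical UNIV (\<lambda>up. if up then x + step \<theta> else x - step \<theta>)"
proof (rule measure_eqI)
  fix A assume "A \<in> sets (P_kernel \<theta> x)"
  then have "A \<in> sets borel" by simp
  then show "emeasure (P_kernel \<theta> x) A
      = emeasure (empirical UNIV (\<lambda>up. if up then x + step \<theta> else x - step \<theta>)) A"
    by (simp add: emeasure_P_kernel emeasure_empirical UNIV_bool step_def divide_ennreal_def
        mult.commute add.commute)
qed simp

lemma \<nu>_points_empirical:
  assumes "m \<ge> 1"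
  shows "\<nu>_points m n = empirical ({1..m} \<times> UNIV) (endpoint (pi / (2 * real n)))"
proof (rule measure_eqI)
  have "sets (\<nu>_points m n) = sets borel"
    unfolding \<nu>_points_def
    by (rule sets_bind) (simp_all add: sets_eq_imp_space_eq[OF sets_\<mu>_points])
  then show "sets (\<nu>_points m n) = sets (empirical ({1..m} \<times> UNIV) (endpoint (pi / (2 * real n))))"
    by simp
  fix A assume "A \<in> sets (\<nu>_points m n)"
  then have A [measurable]: "A \<in> sets borel"
    using \<open>sets (\<nu>_points m n) = sets borel\<close> by simp
  let ?\<theta> = "pi / (2 * real n)"
  have "emeasure (\<nu>_points m n) A
      = (\<integral>\<^sup>+x. (indicator A (x + step ?\<theta>) + indicator A (x - step ?\<theta>)) / 2 \<partial>empirical {1..m} centre)"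
    using A assms by (simp add: emeasure_\<nu>_points \<mu>_points_empirical emeasure_P_kernel step_def
        divide_ennreal_def mult.commute)
  also have "\<dots> = (\<Sum>j=1..m. indicator A (centre j + step ?\<theta>) + indicator A (centre j - step ?\<theta>))
      / of_nat (card ({1..m} \<times> (UNIV :: bool set)))"
    using assms by (subst nn_integral_empirical)
      (simp_all add: ennreal_sum_halves mult.commute)
  also have "\<dots> = emeasure (empirical ({1..m} \<times> UNIV) (endpoint ?\<theta>)) A"
    using A assms by (subst emeasure_empirical)
      (simp_all add: sum_signed_points[unfolded One_nat_def] endpoint_def)
  finally show "emeasure (\<nu>_points m n) A = emeasure (empirical ({1..m} \<times> UNIV) (endpoint ?\<theta>)) A" .
qed

section \<open>Bounds for the two transport costs\<close>

text \<open>
  The second coordinate alone already moves by \<open>sin \<theta>\<close>.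
\<close>

lemma wasserstein1_lower:
  assumes "1 \<le> m" "0 \<le> sin (pi / (2 * real n))" "\<pi> \<in> couplings (\<mu>_points m) (\<nu>_points m n)"
  shows "ennreal (sin (pi / (2 * real n))) \<le> (\<integral>\<^sup>+(x, y). ennreal (norm (y - x)) \<partial>\<pi>)"
proof -
  let ?\<theta> = "pi / (2 * real n)"
  note marg = coupling_marginals[OF assms(3)]
  have [measurable]: "(\<lambda>y :: real ^ 2. y $ k) \<in> borel_measurable borel" for k
    by (intro borel_measurable_continuous_onI continuous_intros)
  have "AE x in \<mu>_points m. x $ 2 = 0"
    unfolding \<mu>_points_empirical[OF assms(1)] using assms(1) by (intro AE_empirical) auto
  then have A: "AE z in \<pi>. fst z $ 2 = 0" by (rule marg)
  have "AE y in \<nu>_points m n. \<bar>y $ 2\<bar> = sin ?\<theta>"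
    unfolding \<nu>_points_empirical[OF assms(1)] using assms(1,2) by (intro AE_empirical) auto
  then have B: "AE z in \<pi>. \<bar>snd z $ 2\<bar> = sin ?\<theta>" by (rule marg)
  have "ennreal (sin ?\<theta>) = (\<integral>\<^sup>+z. ennreal (sin ?\<theta>) \<partial>\<pi>)"
    by (simp add: prob_space.emeasure_space_1[OF marg(2)])
  also have "\<dots> \<le> (\<integral>\<^sup>+(x, y). ennreal (norm (y - x)) \<partial>\<pi>)"
  proof (rule nn_integral_mono_AE, use A B in eventually_elim)
    case (elim z)
    have "\<bar>(snd z - fst z) $ 2\<bar> \<le> norm (snd z - fst z)" by (rule component_le_norm_cart)
    then show ?case using elim by (simp add: case_prod_beta)
  qed
  finally show ?thesis .
qed

lemma norm_step: "norm (step \<theta>) = 1"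
  by (simp add: norm_eq_sqrt_inner inner_vec_def sum_2 flip: power2_eq_square)

lemma norm_step_minus_axis:
  assumes "0 \<le> \<theta>"
  shows "norm (step \<theta> - vector [1, 0]) \<le> \<theta>"
proof -
  have "(norm (step \<theta> - vector [1, 0]))\<^sup>2 = (cos \<theta> - 1)\<^sup>2 + (sin \<theta>)\<^sup>2"
    by (simp add: norm_eq_sqrt_inner inner_vec_def sum_2 power2_eq_square)
  also have "\<dots> = (2 * sin (\<theta> / 2))\<^sup>2"
    using cos_double_sin[of "\<theta> / 2"] sin_cos_squared_add[of \<theta>] by (simp add: power2_eq_square algebra_simps)
  also have "\<dots> \<le> \<theta>\<^sup>2"
    using abs_sin_x_le_abs_x[of "\<theta> / 2"] by (intro abs_le_square_iff[THEN iffD1]) (simp add: abs_mult)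
  finally show ?thesis
    by (rule power2_le_imp_le[OF _ assms])
qed

text \<open>
  The source of the target \<open>(j, up)\<close> in the cheap coupling: the next point in the direction of the
  step, truncated at the ends of the row, so that \<open>(m, True)\<close> and \<open>(1, False)\<close> use \<open>m\<close> and \<open>1\<close>.
\<close>

definition shifted_source :: "nat \<Rightarrow> nat \<times> bool \<Rightarrow> nat" where
  "shifted_source m = (\<lambda>(j, up). if up then min (j + 1) m else max (j - 1) 1)"

text \<open>
  The upward targets use \<open>2, ..., m, m\<close> and the downward ones \<open>1, 1, ..., m - 1\<close>. Exchanging the
  surplus \<open>m\<close> for the surplus \<open>1\<close> turns both into \<open>1, ..., m\<close>.
\<close>

lemma sum_shifted_source:
  fixes f :: "nat \<Rightarrow> 'b::comm_semiring_1"
  assumes "1 \<le> m"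
  shows "(\<Sum>p\<in>{1..m} \<times> UNIV. f (shifted_source m p)) = 2 * (\<Sum>j=1..m. f j)"
proof -
  obtain k where m: "m = Suc k" using assms by (cases m) auto
  have up: "(\<Sum>j=1..m. f (min (j + 1) m)) = (\<Sum>j=1..k. f (Suc j)) + f m"
    by (simp add: m)
  have "(\<Sum>j=1..m. f (max (j - 1) 1)) = f 1 + (\<Sum>j=Suc 1..Suc k. f (max (j - 1) 1))"
    unfolding m by (subst sum.atLeast_Suc_atMost) simp_all
  also have "(\<Sum>j=Suc 1..Suc k. f (max (j - 1) 1)) = (\<Sum>j=1..k. f j)"
    by (subst sum.shift_bounds_cl_Suc_ivl) (auto intro!: sum.cong simp: max_def)
  finally have down: "(\<Sum>j=1..m. f (max (j - 1) 1)) = f 1 + (\<Sum>j=1..k. f j)" .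
  have "(\<Sum>p\<in>{1..m} \<times> UNIV. f (shifted_source m p))
      = (\<Sum>j=1..m. f (min (j + 1) m)) + (\<Sum>j=1..m. f (max (j - 1) 1))"
    by (simp only: sum_signed_points shifted_source_def sum.distrib case_prod_conv if_True if_False)
  also have "\<dots> = (f 1 + (\<Sum>j=1..k. f (Suc j))) + ((\<Sum>j=1..k. f j) + f m)"
    by (simp only: up down add_ac)
  also have "f 1 + (\<Sum>j=1..k. f (Suc j)) = (\<Sum>j=1..m. f j)"
    unfolding m by (subst sum.atLeast_Suc_atMost[of 1 "Suc k"]) (simp_all add: sum.shift_bounds_cl_Suc_ivl del: sum.cl_ivl_Suc)
  also have "(\<Sum>j=1..k. f j) + f m = (\<Sum>j=1..m. f j)"
    by (simp add: m)
  finally show ?thesis by (simp add: mult_2)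
qed

lemma norm_endpoint_shifted_source:
  assumes "j \<in> {1..m}" "0 \<le> \<theta>"
  shows "norm (endpoint \<theta> (j, up) - centre (shifted_source m (j, up)))
    \<le> \<theta> + (if j = (if up then m else 1) then 1 else 0)"
proof (cases "j = (if up then m else 1)")
  case True
  then have "endpoint \<theta> (j, up) - centre (shifted_source m (j, up)) = (if up then step \<theta> else - step \<theta>)"
    by (auto simp: endpoint_def shifted_source_def)
  then show ?thesis using True assms(2) by (auto simp: norm_step)
next
  case False
  then have "endpoint \<theta> (j, up) - centre (shifted_source m (j, up))
      = (if up then step \<theta> - vector [1, 0] else - (step \<theta> - vector [1, 0]))"
    using assms(1) by (auto simp: vec_eq_iff forall_2 shifted_source_def of_nat_diff)
  then show ?thesis using False norm_step_minus_axis[OF assms(2)] by (auto simp: norm_minus_commute)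
qed

lemma wasserstein1_upper:
  assumes "1 \<le> m"
  shows "(INF \<pi>\<in>couplings (\<mu>_points m) (\<nu>_points m n). \<integral>\<^sup>+(x, y). ennreal (norm (y - x)) \<partial>\<pi>)
    \<le> ennreal (pi / (2 * real n) + 1 / real m)"
proof -
  let ?\<theta> = "pi / (2 * real n)"
  let ?I = "{1..m} \<times> (UNIV :: bool set)"
  let ?\<pi> = "empirical ?I (\<lambda>p. (centre (shifted_source m p), endpoint ?\<theta> p))"
  have "empirical ?I (\<lambda>p. centre (shifted_source m p)) = \<mu>_points m"
    using sum_shifted_source[OF assms] by (intro empirical_eq_\<mu>_points assms) (simp add: centre_def)
  then have "?\<pi> \<in> couplings (\<mu>_points m) (\<nu>_points m n)"
    using empirical_in_couplings[of ?I "\<lambda>p. centre (shifted_source m p)" "endpoint ?\<theta>"]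
    by (simp add: \<nu>_points_empirical[OF assms])
  then have "(INF \<pi>\<in>couplings (\<mu>_points m) (\<nu>_points m n). \<integral>\<^sup>+(x, y). ennreal (norm (y - x)) \<partial>\<pi>)
      \<le> (\<integral>\<^sup>+(x, y). ennreal (norm (y - x)) \<partial>?\<pi>)"
    by (rule INF_lower)
  also have "\<dots> = (\<Sum>p\<in>?I. ennreal (norm (endpoint ?\<theta> p - centre (shifted_source m p)))) / of_nat (card ?I)"
    using assms by (subst nn_integral_empirical)
      (simp_all add: measurable_distance norm_minus_commute[of "fst _"])
  also have "\<dots> = ennreal ((\<Sum>p\<in>?I. norm (endpoint ?\<theta> p - centre (shifted_source m p))) / (2 * real m))"
    using assms by (subst ennreal_mean) (simp_all add: mult.commute)
  also have "\<dots> \<le> ennreal (?\<theta> + 1 / real m)"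
  proof (rule ennreal_leI)
    have "(\<Sum>p\<in>?I. norm (endpoint ?\<theta> p - centre (shifted_source m p)))
        \<le> (\<Sum>(j, up)\<in>?I. ?\<theta> + (if j = (if up then m else 1) then 1 else 0))"
      by (rule sum_mono) (use norm_endpoint_shifted_source[of _ m ?\<theta>] in fastforce)
    also have "\<dots> = 2 * real m * ?\<theta> + 2"
      using assms by (simp add: sum.cartesian_product[symmetric] UNIV_bool sum.distrib)
    finally show "(\<Sum>p\<in>?I. norm (endpoint ?\<theta> p - centre (shifted_source m p))) / (2 * real m) \<le> ?\<theta> + 1 / real m"
      using assms by (simp add: field_simps)
  qed
  finally show ?thesis .
qed

text \<open>
  Disintegrated by \<open>P_kernel\<close> itself, whose two equally likely steps cancel. Its only purpose is to
  make the infimum over martingale couplings finite.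
\<close>

lemma kernel_coupling:
  assumes "1 \<le> m"
  shows "empirical ({1..m} \<times> UNIV) (\<lambda>p. (centre (fst p), endpoint (pi / (2 * real n)) p))
    \<in> martingale_couplings (\<mu>_points m) (\<nu>_points m n)"
proof -
  let ?\<theta> = "pi / (2 * real n)"
  let ?I = "{1..m} \<times> (UNIV :: bool set)"
  let ?\<pi> = "empirical ?I (\<lambda>p. (centre (fst p), endpoint ?\<theta> p))"
  have "empirical ?I (\<lambda>p. centre (fst p)) = \<mu>_points m"
    by (intro empirical_eq_\<mu>_points assms) (simp only: sum_signed_points centre_def fst_conv sum_distrib_left mult_2)
  then have "?\<pi> \<in> couplings (\<mu>_points m) (\<nu>_points m n)"
    using empirical_in_couplings[of ?I "\<lambda>p. centre (fst p)" "endpoint ?\<theta>"]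
    by (simp add: \<nu>_points_empirical[OF assms])
  moreover have "disintegration (\<mu>_points m) ?\<pi> (P_kernel ?\<theta>)"
    unfolding disintegration_def
  proof (intro conjI ballI measurable_P_kernel)
    fix A B :: "(real ^ 2) set" assume AB [measurable]: "A \<in> sets borel" "B \<in> sets borel"
    have "A \<times> B \<in> sets borel"
      unfolding borel_prod[symmetric] by measurable
    then have "emeasure ?\<pi> (A \<times> B) = (\<Sum>p\<in>?I. indicator (A \<times> B) (centre (fst p), endpoint ?\<theta> p)) / of_nat (card ?I)"
      using assms by (subst emeasure_empirical) simp_all
    also have "(\<Sum>p\<in>?I. indicator (A \<times> B) (centre (fst p), endpoint ?\<theta> p))
      = (\<Sum>j=1..m. indicator A (centre j) * (indicator B (centre j + step ?\<theta>) + indicator B (centre j - step ?\<theta>)) :: ennreal)"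
      by (simp add: sum_signed_points[unfolded One_nat_def] endpoint_def indicator_times distrib_left)
    also have "\<dots> / of_nat (card ?I)
      = (\<integral>\<^sup>+x\<in>A. (indicator B (x + step ?\<theta>) + indicator B (x - step ?\<theta>)) / 2 \<partial>\<mu>_points m)"
      unfolding \<mu>_points_empirical[OF assms] using assms
      by (subst nn_integral_empirical)
        (simp_all add: ennreal_times_divide mult.commute[of "_ / 2" "indicator A _"] ennreal_sum_halves mult.commute[of "of_nat m" 2])
    also have "\<dots> = (\<integral>\<^sup>+x\<in>A. emeasure (P_kernel ?\<theta> x) B \<partial>\<mu>_points m)"
      using AB by (simp add: emeasure_P_kernel step_def divide_ennreal_def mult.commute)
    finally show "emeasure ?\<pi> (A \<times> B) = (\<integral>\<^sup>+x\<in>A. emeasure (P_kernel ?\<theta> x) B \<partial>\<mu>_points m)" .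
  qed
  moreover have "integrable (P_kernel ?\<theta> x) (\<lambda>y. y)" for x
    unfolding P_kernel_empirical empirical_def
    by (simp add: integrable_distr_eq integrable_measure_pmf_finite)
  moreover have "(\<integral>y. y \<partial>P_kernel ?\<theta> x) = x" for x
    unfolding P_kernel_empirical empirical_def
    by (subst integral_distr) (simp_all add: integral_measure_pmf[of UNIV] UNIV_bool vec_eq_iff field_simps)
  ultimately show ?thesis
    unfolding martingale_couplings_def by blast
qed

lemma martingale_wasserstein1_upper:
  assumes "1 \<le> m"
  shows "(INF \<pi>\<in>martingale_couplings (\<mu>_points m) (\<nu>_points m n). \<integral>\<^sup>+(x, y). ennreal (norm (x - y)) \<partial>\<pi>) \<le> 1"
proof -
  let ?\<theta> = "pi / (2 * real n)"
  let ?I = "{1..m} \<times> (UNIV :: bool set)"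
  let ?\<pi> = "empirical ?I (\<lambda>p. (centre (fst p), endpoint ?\<theta> p))"
  have "norm (centre (fst p) - endpoint ?\<theta> p) = 1" for p
    by (cases p) (simp add: endpoint_def norm_step)
  moreover have "(\<integral>\<^sup>+(x, y). ennreal (norm (x - y)) \<partial>?\<pi>)
      = (\<Sum>p\<in>?I. ennreal (norm (centre (fst p) - endpoint ?\<theta> p))) / of_nat (card ?I)"
    using assms by (subst nn_integral_empirical) (simp_all add: measurable_distance)
  moreover have "\<dots> = ennreal ((\<Sum>p\<in>?I. norm (centre (fst p) - endpoint ?\<theta> p)) / real (card ?I))"
    using assms by (intro ennreal_mean) simp_all
  ultimately have "(\<integral>\<^sup>+(x, y). ennreal (norm (x - y)) \<partial>?\<pi>) = 1"
    using assms by simp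
  then show ?thesis
    using INF_lower[OF kernel_coupling[OF assms, of n], of "\<lambda>\<pi>. \<integral>\<^sup>+(x, y). ennreal (norm (x - y)) \<partial>\<pi>"]
    by simp
qed

text \<open>
  The integrated form of \<open>sin \<theta> \<parallel>X - Y\<parallel> \<ge> (Y\<^sub>1 - X\<^sub>1) Y\<^sub>2\<close>. To stay with nonnegative integrands, \<open>Y\<^sub>2\<close> is
  split into its positive part \<open>Y\<^sub>2\<^sup>+\<close> and its negative part \<open>Y\<^sub>2\<^sup>-\<close> and the negative terms are moved to
  the other side; this is possible since \<open>X\<^sub>1\<close> and \<open>Y\<^sub>1\<close> are nonnegative.
\<close>

lemma martingale_wasserstein1_lower:
  assumes "1 \<le> m" "0 < sin (pi / (2 * real n))" "0 \<le> cos (pi / (2 * real n))"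
    and \<pi>: "\<pi> \<in> martingale_couplings (\<mu>_points m) (\<nu>_points m n)"
  shows "ennreal (cos (pi / (2 * real n))) \<le> (\<integral>\<^sup>+(x, y). ennreal (norm (x - y)) \<partial>\<pi>)"
proof -
  let ?\<theta> = "pi / (2 * real n)"
  let ?I = "{1..m} \<times> (UNIV :: bool set)"
  define s c where "s = sin ?\<theta>" and "c = cos ?\<theta>"
  have sc: "0 < s" "0 \<le> c" "c \<le> 1" using assms by (auto simp: s_def c_def)
  have coupling: "\<pi> \<in> couplings (\<mu>_points m) (\<nu>_points m n)"
    using \<pi> by (simp add: martingale_couplings_def)
  note marg = coupling_marginals[OF coupling]
  note [measurable_cong] = marg(1)
  have [measurable]: "(\<lambda>y :: real ^ 2. y $ k) \<in> borel_measurable borel" for k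
    by (intro borel_measurable_continuous_onI continuous_intros)
  have \<mu>AE: "AE x in \<mu>_points m. x $ 2 = 0" "AE x in \<mu>_points m. 0 \<le> x $ 1 \<and> x $ 1 \<le> real m"
    unfolding \<mu>_points_empirical[OF assms(1)] using assms(1) by (intro AE_empirical; auto)+
  have "AE y in \<nu>_points m n. 0 \<le> y $ 1 \<and> \<bar>y $ 2\<bar> = s"
    unfolding \<nu>_points_empirical[OF assms(1)] using assms(1) sc
    by (intro AE_empirical) (auto simp flip: s_def c_def)
  note AE = marg(5)[OF \<mu>AE(2)] marg(6)[OF this]
  \<comment> \<open>\<open>a = E[X\<^sub>1 Y\<^sub>2\<^sup>+] = E[X\<^sub>1 Y\<^sub>2\<^sup>-]\<close>, \<open>b = E[Y\<^sub>1 Y\<^sub>2\<^sup>-]\<close> and \<open>b' = E[Y\<^sub>1 Y\<^sub>2\<^sup>+]\<close>. Once \<open>b' + a \<le> s C + a + b\<close> holds,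
    \<open>a\<close> cancels because it is finite, and \<open>b' - b = E[Y\<^sub>1 Y\<^sub>2]\<close> is known.\<close>
  define a where "a = (\<integral>\<^sup>+z. ennreal (fst z $ 1) * ennreal (snd z $ 2) \<partial>\<pi>)"
  define b where "b = (\<integral>\<^sup>+z. ennreal (snd z $ 1) * ennreal (- snd z $ 2) \<partial>\<pi>)"
  define b' where "b' = (\<integral>\<^sup>+z. ennreal (snd z $ 1) * ennreal (snd z $ 2) \<partial>\<pi>)"
  define C where "C = (\<integral>\<^sup>+(x, y). ennreal (norm (x - y)) \<partial>\<pi>)"
  have a: "a = (\<integral>\<^sup>+z. ennreal (fst z $ 1) * ennreal (- snd z $ 2) \<partial>\<pi>)"
    unfolding a_def
    using martingale_coupling_orthogonal[OF \<pi> sets_\<mu>_points \<mu>AE(1), of "\<lambda>x. ennreal (x $ 1)"] by simp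
  have "a \<le> (\<integral>\<^sup>+z. ennreal (real m * s) \<partial>\<pi>)"
    unfolding a_def
  proof (rule nn_integral_mono_AE, use AE in eventually_elim)
    case (elim z)
    then have "fst z $ 1 * max 0 (snd z $ 2) \<le> real m * s"
      by (intro mult_mono) auto
    moreover have "ennreal (snd z $ 2) = ennreal (max 0 (snd z $ 2))"
      by (simp add: max_def ennreal_neg)
    ultimately show ?case
      using elim by (simp only: ennreal_leI flip: ennreal_mult')
  qed
  also have "\<dots> < \<top>" by (simp add: prob_space.emeasure_space_1[OF marg(2)])
  finally have a_fin: "a \<noteq> \<top>" by simp
  have "b' + a \<le> ennreal s * C + a + b"
  proof -
    have "b' + a = (\<integral>\<^sup>+z. ennreal (snd z $ 1) * ennreal (snd z $ 2) + ennreal (fst z $ 1) * ennreal (- snd z $ 2) \<partial>\<pi>)"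
      unfolding b'_def a by (rule nn_integral_add[symmetric]) simp_all
    also have "\<dots> \<le> (\<integral>\<^sup>+z. ennreal s * ennreal (norm (fst z - snd z))
        + ennreal (fst z $ 1) * ennreal (snd z $ 2) + ennreal (snd z $ 1) * ennreal (- snd z $ 2) \<partial>\<pi>)"
    proof (rule nn_integral_mono_AE, use AE in eventually_elim)
      case (elim z)
      have "\<bar>(fst z - snd z) $ 1\<bar> \<le> norm (fst z - snd z)" by (rule component_le_norm_cart)
      then have "snd z $ 1 \<le> norm (fst z - snd z) + fst z $ 1"
        "fst z $ 1 \<le> norm (fst z - snd z) + snd z $ 1"
        by auto
      then have *: "s * (snd z $ 1) \<le> s * norm (fst z - snd z) + s * (fst z $ 1)"
        "s * (fst z $ 1) \<le> s * norm (fst z - snd z) + s * (snd z $ 1)"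
        using sc by (simp_all flip: distrib_left)
      consider "snd z $ 2 = s" | "snd z $ 2 = - s" using elim by linarith
      then show ?case
      proof cases
        case 1
        then show ?thesis using * sc elim
          by (simp add: ennreal_neg mult.commute flip: ennreal_mult' ennreal_plus)
      next
        case 2
        then show ?thesis using * sc elim
          by (simp add: ennreal_neg mult.commute flip: ennreal_mult' ennreal_plus)
      qed
    qed
    also have "\<dots> = ennreal s * C + a + b"
      unfolding C_def a_def b_def
      by (simp add: nn_integral_add nn_integral_cmult case_prod_beta')
    finally show ?thesis .
  qed
  then have "b' \<le> ennreal s * C + b"
    using a_fin by (simp add: ennreal_add_left_cancel_le add_ac)
  moreover have "b' = ennreal (s * c) + b" "b \<noteq> \<top>"
  proof -
    have "b' = (\<Sum>p\<in>?I. ennreal (endpoint ?\<theta> p $ 1) * ennreal (endpoint ?\<theta> p $ 2)) / of_nat (card ?I)"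
      unfolding b'_def using assms(1)
      by (subst marg(4)[of "\<lambda>y. ennreal (y $ 1) * ennreal (y $ 2)"])
        (simp_all add: \<nu>_points_empirical nn_integral_empirical)
    also have "(\<Sum>p\<in>?I. ennreal (endpoint ?\<theta> p $ 1) * ennreal (endpoint ?\<theta> p $ 2))
      = (\<Sum>j=1..m. ennreal ((real j + c) * s))"
      unfolding sum_signed_points using sc
      by (intro sum.cong) (simp_all add: ennreal_neg ennreal_mult' flip: s_def c_def)
    also have "\<dots> / of_nat (card ?I) = ennreal ((\<Sum>j=1..m. (real j + c) * s) / real (card ?I))"
      using assms(1) sc by (intro ennreal_mean) auto
    finally have b': "b' = ennreal ((\<Sum>j=1..m. (real j + c) * s) / real (card ?I))" .
    have "b = (\<Sum>p\<in>?I. ennreal (endpoint ?\<theta> p $ 1) * ennreal (- endpoint ?\<theta> p $ 2)) / of_nat (card ?I)"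
      unfolding b_def using assms(1)
      by (subst marg(4)[of "\<lambda>y. ennreal (y $ 1) * ennreal (- y $ 2)"])
        (simp_all add: \<nu>_points_empirical nn_integral_empirical)
    also have "(\<Sum>p\<in>?I. ennreal (endpoint ?\<theta> p $ 1) * ennreal (- endpoint ?\<theta> p $ 2))
      = (\<Sum>j=1..m. ennreal ((real j - c) * s))"
      unfolding sum_signed_points using sc
      by (intro sum.cong) (simp_all add: ennreal_neg ennreal_mult' flip: s_def c_def)
    also have "\<dots> / of_nat (card ?I) = ennreal ((\<Sum>j=1..m. (real j - c) * s) / real (card ?I))"
      using assms(1) sc by (intro ennreal_mean) auto
    finally have b: "b = ennreal ((\<Sum>j=1..m. (real j - c) * s) / real (card ?I))" .
    have "(\<Sum>j=1..m. (real j + c) * s) / real (card ?I)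
        = s * c + (\<Sum>j=1..m. (real j - c) * s) / real (card ?I)"
      using assms(1)
      by (simp add: sum_distrib_right[symmetric] sum.distrib sum_subtractf field_simps)
    moreover have "0 \<le> (\<Sum>j=1..m. (real j - c) * s) / real (card ?I)"
      using sc by (intro divide_nonneg_nonneg sum_nonneg mult_nonneg_nonneg) auto
    ultimately show "b' = ennreal (s * c) + b" "b \<noteq> \<top>"
      using sc by (simp_all add: b' b)
  qed
  ultimately have "ennreal (s * c) \<le> ennreal s * C"
    by (simp add: ennreal_add_left_cancel_le add.commute)
  then have "ennreal s * ennreal c \<le> ennreal s * C"
    using sc by (simp add: ennreal_mult')
  then show ?thesis
    using sc by (simp add: ennreal_mult_le_mult_iff C_def c_def)
qed

theorem proposition1p3:
  shows "filterlim
    (\<lambda>n. martingale_wasserstein1 (\<mu>_points n) (\<nu>_points n n) / wasserstein1 (\<mu>_points n) (\<nu>_points n n))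
    at_top sequentially"
proof -
  have bound: "cos (pi / (2 * real n)) * (real n / (pi / 2 + 1))
      \<le> martingale_wasserstein1 (\<mu>_points n) (\<nu>_points n n) / wasserstein1 (\<mu>_points n) (\<nu>_points n n)"
    if n: "1 \<le> n" for n
  proof -
    let ?\<theta> = "pi / (2 * real n)"
    have \<theta>: "0 < ?\<theta>" "?\<theta> \<le> pi / 2" using n by (auto simp: field_simps)
    have s: "0 < sin ?\<theta>" by (rule sin_gt_zero) (use \<theta> pi_gt_zero in linarith)+
    have c: "0 \<le> cos ?\<theta>" by (rule cos_ge_zero) (use \<theta> in linarith)+
    let ?M = "INF \<pi>\<in>martingale_couplings (\<mu>_points n) (\<nu>_points n n). \<integral>\<^sup>+(x, y). ennreal (norm (x - y)) \<partial>\<pi>"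
    let ?W = "INF \<pi>\<in>couplings (\<mu>_points n) (\<nu>_points n n). \<integral>\<^sup>+(x, y). ennreal (norm (y - x)) \<partial>\<pi>"
    have "ennreal (cos ?\<theta>) \<le> ?M"
      using martingale_wasserstein1_lower[OF n s c] by (intro INF_greatest) blast
    moreover have "?M < \<top>"
      using martingale_wasserstein1_upper[OF n] by (rule le_less_trans) simp
    ultimately have M: "cos ?\<theta> \<le> enn2real ?M"
      using c by (metis enn2real_ennreal enn2real_mono)
    have "ennreal (sin ?\<theta>) \<le> ?W"
      using wasserstein1_lower[OF n less_imp_le[OF s]] by (intro INF_greatest) blast
    moreover have W: "?W \<le> ennreal (?\<theta> + 1 / real n)"
      by (rule wasserstein1_upper[OF n])
    then have "?W < \<top>" by (rule le_less_trans) simp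
    ultimately have W0: "sin ?\<theta> \<le> enn2real ?W"
      using s by (metis enn2real_ennreal enn2real_mono less_imp_le)
    have "enn2real ?W \<le> ?\<theta> + 1 / real n"
      using W \<theta> by (intro enn2real_leI) simp_all
    also have "\<dots> = (pi / 2 + 1) / real n" using n by (simp add: field_simps)
    finally have W1: "enn2real ?W \<le> (pi / 2 + 1) / real n" .
    have "cos ?\<theta> * (real n / (pi / 2 + 1)) = cos ?\<theta> / ((pi / 2 + 1) / real n)" by simp
    also have "\<dots> \<le> enn2real ?M / enn2real ?W"
      using M W0 W1 s c by (intro frac_le) linarith+
    finally show ?thesis
      by (simp add: martingale_wasserstein1_def wasserstein1_def)
  qed
  have "(\<lambda>n. pi / 2 * inverse (real n)) \<longlonglongrightarrow> pi / 2 * 0"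
    by (intro tendsto_intros LIMSEQ_inverse_real_of_nat_add lim_inverse_n)
  then have "(\<lambda>n. cos (pi / (2 * real n))) \<longlonglongrightarrow> 1"
    using tendsto_cos[of "\<lambda>n. pi / 2 * inverse (real n)" 0 sequentially] by (simp add: field_simps)
  moreover have "filterlim (\<lambda>n. real n / (pi / 2 + 1)) at_top sequentially"
    using filterlim_tendsto_pos_mult_at_top[OF tendsto_const[of "1 / (pi / 2 + 1)"] _ filterlim_real_sequentially]
      pi_gt_zero by (simp add: add_pos_pos)
  ultimately have "filterlim (\<lambda>n. cos (pi / (2 * real n)) * (real n / (pi / 2 + 1))) at_top sequentially"
    using filterlim_tendsto_pos_mult_at_top zero_less_one by blast
  then show ?thesis
    by (rule filterlim_at_top_mono) (use bound in \<open>auto intro!: eventually_sequentiallyI[of 1]\<close>)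
qed

end
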